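(* Let $\mathbb{H}(x_1,\dots,x_n)$ be the semifield of fractions of $\mathbb{H}[x_1,\dots,x_n]$, where $\mathbb{H}$ is a bipotent archimedean semifield. Then for any $\gamma_1,\dots,\gamma_n\in\mathbb{H}$ the kernel $\left\langle\frac{x_1}{\gamma_1},\dots,\frac{x_n}{\gamma_n}\right\rangle$ is a maximal kernel of $\mathbb{H}(x_1,\dots,x_n)$.
   Context: Semifields are commutative, have no zero element (all elements are invertible) and are not fields. Bipotent: $a+b\in\{a,b\}$; order $a\le b\iff a+b=b$. Archimedean: $a^k\le b$ for all $k\in\mathbb{Z}$ implies $a=1$. Elements of $\mathbb{H}[x_1,\dots,x_n]$ and $\mathbb{H}(x_1,\dots,x_n)$ are regarded as functions $\mathbb{H}^n\to\mathbb{H}$. A kernel of a semifield $\mathbb S$ is a multiplicative subgroup $K$ such that $xa+yb\in K$ whenever $a,b\in K$, $x,y\in\mathbb S$, $x+y=1$; $\langle A\rangle$ is the smallest kernel containing $A$. A kernel $K$ of $\mathbb{S}$ is maximal if for every kernel $A$ of $\mathbb{S}$, $K\subseteq A$ implies $A=K$ or $A=\mathbb{S}$. *)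

theory Defs
  imports "HOL-Algebra.FiniteProduct"
begin

record 'a semifield = "'a monoid" +
  splus :: "['a, 'a] \<Rightarrow> 'a" (infixl \<open>\<oplus>\<index>\<close> 65)

text \<open>
  Every element is invertible and there is no zero, so the multiplicative structure on the
  whole carrier is an abelian group. Such a structure is never a field: a field has a
  non-invertible element. The one-element semifield is allowed.
\<close>

locale semifield = comm_group S for S (structure) +
  assumes splus_closed [simp]: "\<lbrakk>x \<in> carrier S; y \<in> carrier S\<rbrakk> \<Longrightarrow> x \<oplus> y \<in> carrier S"
    and splus_assoc:
      "\<lbrakk>x \<in> carrier S; y \<in> carrier S; z \<in> carrier S\<rbrakk> \<Longrightarrow> (x \<oplus> y) \<oplus> z = x \<oplus> (y \<oplus> z)"
    and splus_comm: "\<lbrakk>x \<in> carrier S; y \<in> carrier S\<rbrakk> \<Longrightarrow> x \<oplus> y = y \<oplus> x"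
    and splus_distrib:
      "\<lbrakk>x \<in> carrier S; y \<in> carrier S; z \<in> carrier S\<rbrakk> \<Longrightarrow> x \<otimes> (y \<oplus> z) = x \<otimes> y \<oplus> x \<otimes> z"

lemma (in semifield) splus_left_comm:
  "\<lbrakk>x \<in> carrier S; y \<in> carrier S; z \<in> carrier S\<rbrakk> \<Longrightarrow> x \<oplus> (y \<oplus> z) = y \<oplus> (x \<oplus> z)"
  by (metis splus_assoc splus_comm)

definition bipotent :: "('a, 'm) semifield_scheme \<Rightarrow> bool" where
  "bipotent S \<longleftrightarrow> (\<forall>a\<in>carrier S. \<forall>b\<in>carrier S. a \<oplus>\<^bsub>S\<^esub> b \<in> {a, b})"

definition semifield_le :: "('a, 'm) semifield_scheme \<Rightarrow> 'a \<Rightarrow> 'a \<Rightarrow> bool"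
    (infix \<open>\<sqsubseteq>\<index>\<close> 50) where
  "a \<sqsubseteq>\<^bsub>S\<^esub> b \<longleftrightarrow> a \<oplus>\<^bsub>S\<^esub> b = b"

definition archimedean :: "('a, 'm) semifield_scheme \<Rightarrow> bool" where
  "archimedean S \<longleftrightarrow>
    (\<forall>a\<in>carrier S. \<forall>b\<in>carrier S. (\<forall>k::int. a [^]\<^bsub>S\<^esub> k \<sqsubseteq>\<^bsub>S\<^esub> b) \<longrightarrow> a = \<one>\<^bsub>S\<^esub>)"

definition semifield_kernel :: "('a, 'm) semifield_scheme \<Rightarrow> 'a set \<Rightarrow> bool" where
  "semifield_kernel S K \<longleftrightarrow> subgroup K S \<and>
    (\<forall>a\<in>K. \<forall>b\<in>K. \<forall>x\<in>carrier S. \<forall>y\<in>carrier S.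
       x \<oplus>\<^bsub>S\<^esub> y = \<one>\<^bsub>S\<^esub> \<longrightarrow> x \<otimes>\<^bsub>S\<^esub> a \<oplus>\<^bsub>S\<^esub> y \<otimes>\<^bsub>S\<^esub> b \<in> K)"

definition kernel_generated :: "('a, 'm) semifield_scheme \<Rightarrow> 'a set \<Rightarrow> 'a set" where
  "kernel_generated S A = \<Inter>{K. semifield_kernel S K \<and> A \<subseteq> K}"

text \<open>Maximal kernels are not required to be proper.\<close>

definition maximal_kernel :: "('a, 'm) semifield_scheme \<Rightarrow> 'a set \<Rightarrow> bool" where
  "maximal_kernel S K \<longleftrightarrow> semifield_kernel S K \<and>
    (\<forall>A. semifield_kernel S A \<and> K \<subseteq> A \<longrightarrow> A = K \<or> A = carrier S)"

lemma (in semifield) semifield_kernel_carrier: "semifield_kernel S (carrier S)"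
  by (auto simp: semifield_kernel_def subgroup_self)

lemma (in semifield) kernel_generated_is_smallest:
  assumes "A \<subseteq> carrier S"
  shows "semifield_kernel S (kernel_generated S A)"
    and "A \<subseteq> kernel_generated S A"
    and "\<And>K. \<lbrakk>semifield_kernel S K; A \<subseteq> K\<rbrakk> \<Longrightarrow> kernel_generated S A \<subseteq> K"
proof -
  let ?KK = "{K. semifield_kernel S K \<and> A \<subseteq> K}"
  have ne: "?KK \<noteq> {}" using semifield_kernel_carrier assms by blast
  have "subgroup (\<Inter>?KK) S"
    by (rule subgroups_Inter[OF _ ne]) (auto simp: semifield_kernel_def)
  then show "semifield_kernel S (kernel_generated S A)"
    unfolding kernel_generated_def semifield_kernel_def[of S "\<Inter>?KK"]
    by (auto simp: semifield_kernel_def)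
qed (auto simp: kernel_generated_def)

definition function_semifield ::
    "('a, 'm) semifield_scheme \<Rightarrow> 'b set \<Rightarrow> ('b \<Rightarrow> 'a) semifield" where
  "function_semifield H X =
    \<lparr>carrier = X \<rightarrow>\<^sub>E carrier H,
     mult = (\<lambda>f g. \<lambda>v\<in>X. f v \<otimes>\<^bsub>H\<^esub> g v),
     one = (\<lambda>v\<in>X. \<one>\<^bsub>H\<^esub>),
     splus = (\<lambda>f g. \<lambda>v\<in>X. f v \<oplus>\<^bsub>H\<^esub> g v)\<rparr>"

text \<open>\<open>H\<^sup>n\<close>, with coordinates indexed by \<open>1, \<dots>, n\<close>.\<close>

definition affine_space :: "('a, 'm) semifield_scheme \<Rightarrow> nat \<Rightarrow> (nat \<Rightarrow> 'a) set" where
  "affine_space H n = {1..n} \<rightarrow>\<^sub>E carrier H"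

definition const_fun ::
    "('a, 'm) semifield_scheme \<Rightarrow> nat \<Rightarrow> 'a \<Rightarrow> (nat \<Rightarrow> 'a) \<Rightarrow> 'a" where
  "const_fun H n c = (\<lambda>v\<in>affine_space H n. c)"

definition coord_fun ::
    "('a, 'm) semifield_scheme \<Rightarrow> nat \<Rightarrow> nat \<Rightarrow> (nat \<Rightarrow> 'a) \<Rightarrow> 'a" where
  "coord_fun H n i = (\<lambda>v\<in>affine_space H n. v i)"

definition monomial_fun ::
    "('a, 'm) semifield_scheme \<Rightarrow> nat \<Rightarrow> 'a \<Rightarrow> (nat \<Rightarrow> nat) \<Rightarrow> (nat \<Rightarrow> 'a) \<Rightarrow> 'a" where
  "monomial_fun H n c e =
    (\<lambda>v\<in>affine_space H n. c \<otimes>\<^bsub>H\<^esub> (\<Otimes>\<^bsub>H\<^esub>i\<in>{1..n}. v i [^]\<^bsub>H\<^esub> e i))"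

text \<open>
  Since \<open>H\<close> has no zero, a polynomial is a finite nonempty sum of monomials. A repeated
  exponent vector does no harm: by distributivity its coefficients add up.
\<close>

inductive_set polynomial_funs ::
    "('a, 'm) semifield_scheme \<Rightarrow> nat \<Rightarrow> ((nat \<Rightarrow> 'a) \<Rightarrow> 'a) set"
  for H (structure) and n where
  monomial: "c \<in> carrier H \<Longrightarrow> monomial_fun H n c e \<in> polynomial_funs H n"
| sum: "\<lbrakk>p \<in> polynomial_funs H n; q \<in> polynomial_funs H n\<rbrakk> \<Longrightarrow>
    p \<oplus>\<^bsub>function_semifield H (affine_space H n)\<^esub> q \<in> polynomial_funs H n"

text \<open>
  The semifield of fractions of the polynomial functions, realised inside the semifield of
  all functions on \<open>H\<^sup>n\<close>, where the polynomial functions are already invertible.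
\<close>

definition rational_functions ::
    "('a, 'm) semifield_scheme \<Rightarrow> nat \<Rightarrow> ((nat \<Rightarrow> 'a) \<Rightarrow> 'a) semifield" where
  "rational_functions H n =
    (let F = function_semifield H (affine_space H n)
     in F\<lparr>carrier := {p \<otimes>\<^bsub>F\<^esub> inv\<^bsub>F\<^esub> q | p q.
                       p \<in> polynomial_funs H n \<and> q \<in> polynomial_funs H n}\<rparr>)"

lemma semifield_function_semifield:
  fixes H (structure)
  assumes "semifield H"
  shows "semifield (function_semifield H X)"
proof -
  interpret H: semifield H by fact
  have "comm_group (function_semifield H X)"
  proof (rule comm_groupI)
    fix f assume f: "f \<in> carrier (function_semifield H X)"
    then have fv: "f v \<in> carrier H" if "v \<in> X" for v
      using that by (auto simp: function_semifield_def)
    let ?g = "\<lambda>v\<in>X. inv (f v)"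
    have "?g \<in> carrier (function_semifield H X)"
      using fv by (auto simp: function_semifield_def)
    moreover have "?g \<otimes>\<^bsub>function_semifield H X\<^esub> f = \<one>\<^bsub>function_semifield H X\<^esub>"
      using fv by (auto simp: function_semifield_def intro!: restrict_ext)
    ultimately show "\<exists>g\<in>carrier (function_semifield H X).
        g \<otimes>\<^bsub>function_semifield H X\<^esub> f = \<one>\<^bsub>function_semifield H X\<^esub>" by blast
  next
    fix f assume "f \<in> carrier (function_semifield H X)"
    then show "\<one>\<^bsub>function_semifield H X\<^esub> \<otimes>\<^bsub>function_semifield H X\<^esub> f = f"
      by (intro extensionalityI[of _ X]) (auto simp: function_semifield_def PiE_iff)
  next
    fix f g assume "f \<in> carrier (function_semifield H X)" "g \<in> carrier (function_semifield H X)"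
    then show "f \<otimes>\<^bsub>function_semifield H X\<^esub> g = g \<otimes>\<^bsub>function_semifield H X\<^esub> f"
      by (auto simp: function_semifield_def PiE_iff H.m_comm intro!: restrict_ext)
  qed (auto simp: function_semifield_def PiE_iff H.m_assoc intro!: restrict_ext)
  then show ?thesis
    unfolding semifield_def semifield_axioms_def
    by (auto simp: function_semifield_def PiE_iff H.splus_assoc H.splus_comm H.splus_left_comm H.splus_distrib
             intro!: restrict_ext)
qed

lemma monomial_fun_closed:
  assumes "semifield H" "c \<in> carrier H"
  shows "monomial_fun H n c e \<in> carrier (function_semifield H (affine_space H n))"
proof -
  interpret H: semifield H by fact
  show ?thesis
    using assms(2)
    by (auto simp: monomial_fun_def function_semifield_def affine_space_def PiE_mem
             intro!: H.m_closed H.finprod_closed)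
qed

lemma polynomial_funs_closed:
  assumes "semifield H" "p \<in> polynomial_funs H n"
  shows "p \<in> carrier (function_semifield H (affine_space H n))"
proof -
  interpret F: semifield "function_semifield H (affine_space H n)"
    by (rule semifield_function_semifield) fact
  show ?thesis
    using assms(2) by induction (auto simp: monomial_fun_closed assms(1))
qed

lemma monomial_fun_mult:
  fixes H (structure)
  assumes "semifield H" "c \<in> carrier H" "d \<in> carrier H"
  shows "monomial_fun H n c e \<otimes>\<^bsub>function_semifield H (affine_space H n)\<^esub> monomial_fun H n d e'
    = monomial_fun H n (c \<otimes> d) (\<lambda>i. e i + e' i)"
proof -
  interpret H: semifield H by fact
  show ?thesis
    unfolding monomial_fun_def function_semifield_def monoid.select_convs
  proof (rule restrict_ext)
    fix v assume v: "v \<in> affine_space H n"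
    let ?P = "\<lambda>e. \<Otimes>i\<in>{1..n}. v i [^] (e i :: nat)"
    have vc: "v i \<in> carrier H" if "i \<in> {1..n}" for i
      using v that by (auto simp: affine_space_def)
    then have cl: "(\<lambda>i. v i [^] (e i :: nat)) \<in> {1..n} \<rightarrow> carrier H" for e
      by auto
    have "?P (\<lambda>i. e i + e' i) = (\<Otimes>i\<in>{1..n}. v i [^] e i \<otimes> v i [^] e' i)"
      using vc by (intro H.finprod_cong') (auto simp: H.nat_pow_mult)
    also have "\<dots> = ?P e \<otimes> ?P e'" by (rule H.finprod_multf[OF cl cl])
    finally have "?P (\<lambda>i. e i + e' i) = ?P e \<otimes> ?P e'" .
    then show "(\<lambda>v\<in>affine_space H n. c \<otimes> (\<Otimes>i\<in>{1..n}. v i [^] e i)) v \<otimes>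
        (\<lambda>v\<in>affine_space H n. d \<otimes> (\<Otimes>i\<in>{1..n}. v i [^] e' i)) v
        = c \<otimes> d \<otimes> (\<Otimes>i\<in>{1..n}. v i [^] (e i + e' i))"
      using v assms cl by (simp add: H.m_ac)
  qed
qed

lemma polynomial_funs_mult:
  assumes "semifield H" "p \<in> polynomial_funs H n" "q \<in> polynomial_funs H n"
  shows "p \<otimes>\<^bsub>function_semifield H (affine_space H n)\<^esub> q \<in> polynomial_funs H n"
proof -
  interpret H: semifield H by fact
  interpret F: semifield "function_semifield H (affine_space H n)"
    by (rule semifield_function_semifield) fact
  note cl = polynomial_funs_closed[OF assms(1)]
  have m: "monomial_fun H n c e \<otimes>\<^bsub>function_semifield H (affine_space H n)\<^esub> q
      \<in> polynomial_funs H n" if c: "c \<in> carrier H" for c e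
    using assms(3)
  proof induction
    case (monomial d e')
    then show ?case
      using c by (simp add: monomial_fun_mult[OF assms(1)] polynomial_funs.monomial)
  next
    case (sum p q)
    then show ?case
      using c by (simp add: F.splus_distrib cl monomial_fun_closed assms(1) polynomial_funs.sum)
  qed
  show ?thesis
    using assms(2)
  proof induction
    case (monomial c e)
    then show ?case by (rule m)
  next
    case (sum p p')
    have "(p \<oplus>\<^bsub>function_semifield H (affine_space H n)\<^esub> p')
            \<otimes>\<^bsub>function_semifield H (affine_space H n)\<^esub> q =
          p \<otimes>\<^bsub>function_semifield H (affine_space H n)\<^esub> q
            \<oplus>\<^bsub>function_semifield H (affine_space H n)\<^esub>
          p' \<otimes>\<^bsub>function_semifield H (affine_space H n)\<^esub> q"
      using sum.hyps assms(3)
      by (simp add: F.m_comm[of _ q] F.splus_distrib cl)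
    then show ?case using sum.IH by (simp add: polynomial_funs.sum)
  qed
qed

lemma const_fun_polynomial:
  assumes "semifield H" "c \<in> carrier H"
  shows "const_fun H n c \<in> polynomial_funs H n"
proof -
  interpret H: semifield H by fact
  have "const_fun H n c = monomial_fun H n c (\<lambda>_. 0)"
    using assms(2) by (simp add: const_fun_def monomial_fun_def)
  then show ?thesis using assms(2) by (simp add: polynomial_funs.monomial)
qed

lemma coord_fun_polynomial:
  assumes "semifield H" "i \<in> {1..n}"
  shows "coord_fun H n i \<in> polynomial_funs H n"
proof -
  interpret H: semifield H by fact
  have "coord_fun H n i = monomial_fun H n \<one>\<^bsub>H\<^esub> (\<lambda>j. if j = i then 1 else 0)"
    unfolding coord_fun_def monomial_fun_def
  proof (rule restrict_ext)
    fix v assume v: "v \<in> affine_space H n"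
    then have vc: "v j \<in> carrier H" if "j \<in> {1..n}" for j
      using that by (auto simp: affine_space_def PiE_mem)
    have "(\<Otimes>\<^bsub>H\<^esub>j\<in>{1..n}. v j [^]\<^bsub>H\<^esub> (if j = i then 1 else 0 :: nat)) =
          (\<Otimes>\<^bsub>H\<^esub>j\<in>{1..n}. if i = j then v j else \<one>\<^bsub>H\<^esub>)"
      using vc by (intro H.finprod_cong') auto
    also have "\<dots> = v i"
      using vc assms(2) by (intro H.finprod_singleton) auto
    finally show "v i = \<one>\<^bsub>H\<^esub> \<otimes>\<^bsub>H\<^esub>
        (\<Otimes>\<^bsub>H\<^esub>j\<in>{1..n}. v j [^]\<^bsub>H\<^esub> (if j = i then 1 else 0 :: nat))"
      using vc assms(2) by simp
  qed
  then show ?thesis by (simp add: polynomial_funs.monomial)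
qed

lemma semifield_rational_functions:
  assumes "semifield H"
  shows "semifield (rational_functions H n)"
proof -
  interpret H: semifield H by fact
  define F where "F = function_semifield H (affine_space H n)"
  interpret F: semifield F
    unfolding F_def by (rule semifield_function_semifield) fact
  define P where "P = polynomial_funs H n"
  define R where "R = {p \<otimes>\<^bsub>F\<^esub> inv\<^bsub>F\<^esub> q | p q. p \<in> P \<and> q \<in> P}"
  have R: "rational_functions H n = F\<lparr>carrier := R\<rparr>"
    by (simp add: rational_functions_def R_def P_def F_def Let_def)
  have RI: "p \<otimes>\<^bsub>F\<^esub> inv\<^bsub>F\<^esub> q \<in> R" if "p \<in> P" "q \<in> P" for p q
    using that unfolding R_def by blast
  have cl: "p \<in> carrier F" if "p \<in> P" for p
    using polynomial_funs_closed[OF assms] that by (simp add: P_def F_def)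
  have mP: "p \<otimes>\<^bsub>F\<^esub> q \<in> P" if "p \<in> P" "q \<in> P" for p q
    using polynomial_funs_mult[OF assms] that by (simp add: P_def F_def)
  have sP: "p \<oplus>\<^bsub>F\<^esub> q \<in> P" if "p \<in> P" "q \<in> P" for p q
    using polynomial_funs.sum that by (simp add: P_def F_def)
  have oP: "const_fun H n \<one>\<^bsub>H\<^esub> \<in> P"
    by (simp add: P_def const_fun_polynomial assms)
  have Rc: "R \<subseteq> carrier F" by (auto simp: R_def cl)
  have Rm: "f \<otimes>\<^bsub>F\<^esub> g \<in> R" if fg: "f \<in> R" "g \<in> R" for f g
  proof -
    obtain p q p' q' where *: "f = p \<otimes>\<^bsub>F\<^esub> inv\<^bsub>F\<^esub> q" "g = p' \<otimes>\<^bsub>F\<^esub> inv\<^bsub>F\<^esub> q'"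
      and P: "p \<in> P" "q \<in> P" "p' \<in> P" "q' \<in> P"
      using fg unfolding R_def by blast
    have "f \<otimes>\<^bsub>F\<^esub> g = (p \<otimes>\<^bsub>F\<^esub> p') \<otimes>\<^bsub>F\<^esub> inv\<^bsub>F\<^esub> (q \<otimes>\<^bsub>F\<^esub> q')"
      using P by (simp add: * cl F.inv_mult F.m_ac)
    then show ?thesis using P by (simp add: RI mP)
  qed
  have Ri: "inv\<^bsub>F\<^esub> f \<in> R" if f: "f \<in> R" for f
  proof -
    obtain p q where *: "f = p \<otimes>\<^bsub>F\<^esub> inv\<^bsub>F\<^esub> q" and P: "p \<in> P" "q \<in> P"
      using f unfolding R_def by blast
    have "inv\<^bsub>F\<^esub> f = q \<otimes>\<^bsub>F\<^esub> inv\<^bsub>F\<^esub> p"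
      using P by (simp add: * cl F.inv_mult F.m_comm)
    then show ?thesis using P by (auto simp: R_def)
  qed
  have Rs: "f \<oplus>\<^bsub>F\<^esub> g \<in> R" if fg: "f \<in> R" "g \<in> R" for f g
  proof -
    obtain p q p' q' where *: "f = p \<otimes>\<^bsub>F\<^esub> inv\<^bsub>F\<^esub> q" "g = p' \<otimes>\<^bsub>F\<^esub> inv\<^bsub>F\<^esub> q'"
      and P: "p \<in> P" "q \<in> P" "p' \<in> P" "q' \<in> P"
      using fg unfolding R_def by blast
    have c: "p \<in> carrier F" "q \<in> carrier F" "p' \<in> carrier F" "q' \<in> carrier F"
      using P cl by auto
    let ?d = "inv\<^bsub>F\<^esub> (q \<otimes>\<^bsub>F\<^esub> q')"
    have e: "x \<otimes>\<^bsub>F\<^esub> (inv\<^bsub>F\<^esub> x \<otimes>\<^bsub>F\<^esub> y) = y" if "x \<in> carrier F" "y \<in> carrier F" for x y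
      using that by (simp flip: F.m_assoc)
    have 1: "?d \<otimes>\<^bsub>F\<^esub> (p \<otimes>\<^bsub>F\<^esub> q') = f"
      using c by (simp add: * F.inv_mult F.m_ac e)
    have 2: "?d \<otimes>\<^bsub>F\<^esub> (p' \<otimes>\<^bsub>F\<^esub> q) = g"
      using c by (simp add: * F.inv_mult F.m_ac e)
    have "?d \<otimes>\<^bsub>F\<^esub> (p \<otimes>\<^bsub>F\<^esub> q' \<oplus>\<^bsub>F\<^esub> p' \<otimes>\<^bsub>F\<^esub> q) = f \<oplus>\<^bsub>F\<^esub> g"
      using c by (simp add: F.splus_distrib 1 2 del: F.inv_mult_group)
    then have "f \<oplus>\<^bsub>F\<^esub> g = (p \<otimes>\<^bsub>F\<^esub> q' \<oplus>\<^bsub>F\<^esub> p' \<otimes>\<^bsub>F\<^esub> q) \<otimes>\<^bsub>F\<^esub> ?d"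
      using c by (metis F.inv_closed F.m_closed F.m_comm F.splus_closed)
    then show ?thesis using P by (simp add: RI mP sP)
  qed
  have "R \<noteq> {}" using oP by (auto simp: R_def)
  then have "subgroup R F"
    by (intro F.subgroupI) (use Rc Rm Ri in auto)
  then have "comm_group (F\<lparr>carrier := R\<rparr>)"
    using F.subgroup_imp_group Rc
    by (auto simp: comm_group_def intro!: group.group_comm_groupI[THEN comm_group.axioms(1)] F.m_comm)
  then show ?thesis
    unfolding R semifield_def semifield_axioms_def
    using Rs Rc by (auto simp: F.splus_assoc F.splus_comm F.splus_left_comm F.splus_distrib subset_iff)
qed

end

theory Submission
  imports Defs "HOL-Algebra.Generated_Groups"
begin

text \<open>
  Call \<open>f\<close> normalisable if \<open>f / f(\<gamma>)\<close> lies in \<open>K = \<langle>x\<^sub>1/\<gamma>\<^sub>1, \<dots>, x\<^sub>n/\<gamma>\<^sub>n\<rangle>\<close>. With \<open>a = p(\<gamma>)\<close> and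
  \<open>b = q(\<gamma>)\<close>, the identity \<open>(p + q)/(a + b) = (a/(a + b)) (p/a) + (b/(a + b)) (q/b)\<close> exhibits the
  left-hand side as a convex combination, so normalisable functions are closed under addition;
  they also form a multiplicative group containing constants and coordinates. Hence every rational
  function is normalisable. A kernel strictly above \<open>K\<close> therefore contains a constant \<open>c \<noteq> 1\<close>, whose
  powers bound every other constant above and below by the archimedean property; since kernels are
  order-convex, it contains all constants, and thus everything.
\<close>

section \<open>Kernels as order-convex subgroups, and powers in archimedean semifields\<close>

context semifield
begin

lemma splus_distrib_right:
  "\<lbrakk>x \<in> carrier S; y \<in> carrier S; z \<in> carrier S\<rbrakk> \<Longrightarrow> (x \<oplus> y) \<otimes> z = x \<otimes> z \<oplus> y \<otimes> z"
  by (metis splus_distrib m_comm splus_closed)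

text \<open>Simplifies a convex combination of quotients: with
  \<open>z = inv (a \<oplus> b)\<close>, the weight \<open>a \<otimes> z\<close> cancels the
  denominator of \<open>p \<otimes> inv a\<close> and leaves \<open>p \<otimes> z\<close>.\<close>

lemma mult_divide_cancel:
  assumes "x \<in> carrier S" "y \<in> carrier S" "z \<in> carrier S"
  shows "(x \<otimes> z) \<otimes> (y \<otimes> inv x) = y \<otimes> z"
proof -
  have "(x \<otimes> z) \<otimes> (y \<otimes> inv x) = x \<otimes> (inv x \<otimes> (y \<otimes> z))"
    using assms by (simp add: m_ac)
  also have "\<dots> = y \<otimes> z"
    using assms by (simp flip: m_assoc)
  finally show ?thesis .
qed

lemma semifield_kernel_combination:
  "\<lbrakk>semifield_kernel S K; a \<in> K; b \<in> K; x \<in> carrier S; y \<in> carrier S; x \<oplus> y = \<one>\<rbrakk>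
    \<Longrightarrow> x \<otimes> a \<oplus> y \<otimes> b \<in> K"
  by (simp add: semifield_kernel_def)

lemma semifield_kernel_divide_splus:
  assumes K: "semifield_kernel S K"
    and c: "p \<in> carrier S" "q \<in> carrier S" "a \<in> carrier S" "b \<in> carrier S"
    and m: "p \<otimes> inv a \<in> K" "q \<otimes> inv b \<in> K"
  shows "(p \<oplus> q) \<otimes> inv (a \<oplus> b) \<in> K"
proof -
  let ?x = "a \<otimes> inv (a \<oplus> b)" and ?y = "b \<otimes> inv (a \<oplus> b)"
  have "?x \<oplus> ?y = \<one>"
    using c by (simp flip: splus_distrib_right)
  then have "?x \<otimes> (p \<otimes> inv a) \<oplus> ?y \<otimes> (q \<otimes> inv b) \<in> K"
    using semifield_kernel_combination[OF K m] c by simp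
  then show ?thesis using c by (simp add: mult_divide_cancel splus_distrib_right)
qed

text \<open>The weights \<open>\<one>\<close> and \<open>d \<otimes> inv b\<close> sum to
  \<open>\<one>\<close> because \<open>b\<close> absorbs \<open>d\<close>. With them the combination
  of \<open>a\<close> and \<open>b\<close> is \<open>a \<oplus> d\<close>, which is \<open>d\<close>
  because \<open>d\<close> absorbs \<open>a\<close>.\<close>

lemma semifield_kernel_convex:
  assumes K: "semifield_kernel S K" and ab: "a \<in> K" "b \<in> K" and d: "d \<in> carrier S"
    and "a \<sqsubseteq> d" "d \<sqsubseteq> b"
  shows "d \<in> K"
proof -
  have c: "a \<in> carrier S" "b \<in> carrier S"
    using K ab by (auto simp: semifield_kernel_def dest: subgroup.mem_carrier)
  have "\<one> \<oplus> d \<otimes> inv b = (b \<oplus> d) \<otimes> inv b"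
    using c d by (simp add: splus_distrib_right)
  also have "\<dots> = \<one>"
    using assms(6) c d by (simp add: semifield_le_def splus_comm)
  finally have "\<one> \<otimes> a \<oplus> (d \<otimes> inv b) \<otimes> b \<in> K"
    using semifield_kernel_combination[OF K ab, of \<one>] c d by simp
  then show ?thesis
    using assms(5) c d by (simp add: semifield_le_def m_assoc)
qed

text \<open>As \<open>c \<noteq> \<one>\<close>, the archimedean property denies that
  \<open>d\<close> bounds all powers of \<open>c\<close>; bipotence makes the order total, so a
  power not below \<open>d\<close> lies above it. The exponent may be negative.\<close>

lemma archimedean_upper_power:
  assumes "bipotent S" "archimedean S" "c \<in> carrier S" "c \<noteq> \<one>" "d \<in> carrier S"
  obtains k :: int where "d \<sqsubseteq> c [^] k"
proof -
  obtain k :: int where k: "\<not> c [^] k \<sqsubseteq> d"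
    using assms unfolding archimedean_def by blast
  have "c [^] k \<oplus> d \<in> {c [^] k, d}"
    using assms unfolding bipotent_def by simp
  then have "d \<sqsubseteq> c [^] k"
    using k assms by (simp add: semifield_le_def splus_comm)
  then show thesis ..
qed

text \<open>Inversion reverses the order, so an upper bound \<open>c [^] k\<close> of
  \<open>inv d\<close> becomes the lower bound \<open>c [^] (- k)\<close> of
  \<open>d\<close>.\<close>

lemma archimedean_lower_power:
  assumes "bipotent S" "archimedean S" "c \<in> carrier S" "c \<noteq> \<one>" "d \<in> carrier S"
  obtains k :: int where "c [^] k \<sqsubseteq> d"
proof -
  obtain k :: int where k: "inv d \<sqsubseteq> c [^] k"
    using archimedean_upper_power assms by (metis inv_closed)
  let ?u = "c [^] k"
  have u: "?u \<in> carrier S" using assms by simp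
  \<comment> \<open>The same product is computed twice: distributing gives
    \<open>inv ?u \<oplus> d\<close>, while absorbing \<open>inv d\<close> into \<open>?u\<close>
    first gives \<open>d\<close>.\<close>
  have "(inv d \<oplus> ?u) \<otimes> (d \<otimes> inv ?u) = inv ?u \<oplus> d"
  proof -
    have "inv d \<otimes> (d \<otimes> inv ?u) = inv ?u" "?u \<otimes> (d \<otimes> inv ?u) = d"
      using u assms(5) by (simp flip: m_assoc, simp add: m_lcomm[of ?u])
    then show ?thesis using u assms(5) by (simp add: splus_distrib_right)
  qed
  moreover have "(inv d \<oplus> ?u) \<otimes> (d \<otimes> inv ?u) = d"
    using k u assms(5) by (simp add: semifield_le_def m_lcomm[of ?u])
  ultimately have "c [^] (- k) \<sqsubseteq> d"
    using assms by (simp add: semifield_le_def int_pow_neg)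
  then show thesis ..
qed

end

section \<open>Rational functions as quotients of polynomial functions\<close>

lemma rational_functions_simps:
  "f \<otimes>\<^bsub>rational_functions H n\<^esub> g = (\<lambda>v\<in>affine_space H n. f v \<otimes>\<^bsub>H\<^esub> g v)"
  "f \<oplus>\<^bsub>rational_functions H n\<^esub> g = (\<lambda>v\<in>affine_space H n. f v \<oplus>\<^bsub>H\<^esub> g v)"
  "\<one>\<^bsub>rational_functions H n\<^esub> = (\<lambda>v\<in>affine_space H n. \<one>\<^bsub>H\<^esub>)"
  by (simp_all add: rational_functions_def function_semifield_def Let_def)

lemma rational_functions_carrier_subset:
  assumes "semifield H"
  shows "carrier (rational_functions H n) \<subseteq> affine_space H n \<rightarrow>\<^sub>E carrier H"
proof -
  let ?F = "function_semifield H (affine_space H n)"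
  interpret F: semifield ?F
    by (rule semifield_function_semifield) fact
  have "carrier (rational_functions H n) \<subseteq> carrier ?F"
    using polynomial_funs_closed[OF assms]
    by (auto simp: rational_functions_def Let_def)
  then show ?thesis by (simp add: function_semifield_def)
qed

lemma polynomial_funs_subset_rational_functions:
  assumes "semifield H"
  shows "polynomial_funs H n \<subseteq> carrier (rational_functions H n)"
proof
  fix p assume p: "p \<in> polynomial_funs H n"
  interpret H: semifield H by fact
  let ?F = "function_semifield H (affine_space H n)"
  interpret F: semifield ?F
    by (rule semifield_function_semifield) fact
  have one: "\<one>\<^bsub>?F\<^esub> \<in> polynomial_funs H n"
    using const_fun_polynomial[OF assms H.one_closed, of n]
    by (simp add: const_fun_def function_semifield_def)
  have "p = p \<otimes>\<^bsub>?F\<^esub> inv\<^bsub>?F\<^esub> \<one>\<^bsub>?F\<^esub>"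
    using polynomial_funs_closed[OF assms p] by simp
  then show "p \<in> carrier (rational_functions H n)"
    using p one unfolding rational_functions_def Let_def by force
qed

text \<open>Inverses depend on the carrier, and \<open>rational_functions\<close> is defined with
  those of the ambient function semifield. Multiplication is shared, so
  \<open>f \<otimes> q = p\<close> holds in both structures and can be solved for \<open>f\<close>
  in the smaller one.\<close>

lemma rational_functions_divide:
  assumes "semifield H" "f \<in> carrier (rational_functions H n)"
  obtains p q where "p \<in> polynomial_funs H n" "q \<in> polynomial_funs H n"
    "f = p \<otimes>\<^bsub>rational_functions H n\<^esub> inv\<^bsub>rational_functions H n\<^esub> q"
proof -
  let ?F = "function_semifield H (affine_space H n)" and ?R = "rational_functions H n"
  interpret F: semifield ?F
    by (rule semifield_function_semifield) fact
  interpret R: semifield ?R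
    by (rule semifield_rational_functions) fact
  obtain p q where pq: "p \<in> polynomial_funs H n" "q \<in> polynomial_funs H n"
    and f: "f = p \<otimes>\<^bsub>?F\<^esub> inv\<^bsub>?F\<^esub> q"
    using assms(2) by (auto simp: rational_functions_def Let_def)
  have "f \<otimes>\<^bsub>?R\<^esub> q = f \<otimes>\<^bsub>?F\<^esub> q"
    by (simp add: rational_functions_def Let_def)
  also have "\<dots> = p"
    using pq polynomial_funs_closed[OF assms(1)] by (simp add: f F.m_assoc)
  finally have "f = p \<otimes>\<^bsub>?R\<^esub> inv\<^bsub>?R\<^esub> q"
    using pq polynomial_funs_subset_rational_functions[OF assms(1)] assms(2)
    by (intro R.inv_solve_right[THEN iffD2]) auto
  with pq show thesis by (rule that)
qed

section \<open>Evaluation at a point and constant functions\<close>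

lemma eval_hom:
  assumes "semifield H" "v \<in> affine_space H n"
  shows "(\<lambda>f. f v) \<in> hom (rational_functions H n) H"
  using assms rational_functions_carrier_subset[OF assms(1)]
  by (auto simp: hom_def rational_functions_simps)

text \<open>Composed with evaluation at \<open>v\<close>, this makes
  \<open>f \<mapsto> const_fun H n (f v)\<close> a group endomorphism of the rational
  functions.\<close>

lemma const_fun_hom:
  assumes "semifield H"
  shows "const_fun H n \<in> hom H (rational_functions H n)"
  using const_fun_polynomial[OF assms] polynomial_funs_subset_rational_functions[OF assms, of n]
  by (auto simp: hom_def rational_functions_simps const_fun_def intro!: restrict_ext)

lemma const_fun_splus:
  "const_fun H n (a \<oplus>\<^bsub>H\<^esub> b) = const_fun H n a \<oplus>\<^bsub>rational_functions H n\<^esub> const_fun H n b"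
  by (auto simp: rational_functions_simps const_fun_def intro!: restrict_ext)

text \<open>Monomials are defined pointwise by products in \<open>H\<close>. Written as products of
  constants and coordinates in the semifield of rational functions, they lie in every subgroup
  containing these factors.\<close>

lemma monomial_fun_eq_finprod:
  assumes "semifield H" "c \<in> carrier H"
  shows "monomial_fun H n c e = const_fun H n c \<otimes>\<^bsub>rational_functions H n\<^esub>
    finprod (rational_functions H n) (\<lambda>i. coord_fun H n i [^]\<^bsub>rational_functions H n\<^esub> e i) {1..n}"
proof -
  let ?R = "rational_functions H n"
  interpret H: semifield H by fact
  interpret R: semifield ?R
    by (rule semifield_rational_functions) fact
  have co: "coord_fun H n i \<in> carrier ?R" if "i \<in> {1..n}" for i
    using coord_fun_polynomial[OF assms(1) that] polynomial_funs_subset_rational_functions[OF assms(1)] by blast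
  \<comment> \<open>Generalised from \<open>{1..n}\<close> to subsets \<open>J\<close> for
    induction. The bound on \<open>J\<close> keeps the coordinate functions in the carrier.\<close>
  have ev: "finprod ?R (\<lambda>i. coord_fun H n i [^]\<^bsub>?R\<^esub> e i) J v = (\<Otimes>\<^bsub>H\<^esub>i\<in>J. v i [^]\<^bsub>H\<^esub> e i)"
    if J: "finite J" "J \<subseteq> {1..n}" and v: "v \<in> affine_space H n" for J v
    using J
  proof (induction J rule: finite_induct)
    case empty
    then show ?case using v by (simp add: rational_functions_simps)
  next
    case (insert i J)
    have vc: "v j \<in> carrier H" if "j \<in> insert i J" for j
      using v that insert.prems by (auto simp: affine_space_def PiE_iff)
    interpret ev: group_hom ?R H "\<lambda>f. f v"
      by (intro group_hom.intro group_hom_axioms.intro eval_hom assms(1) v R.is_group H.is_group)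
    have pw: "(coord_fun H n i [^]\<^bsub>?R\<^esub> e i) v = v i [^]\<^bsub>H\<^esub> e i"
      using ev.hom_nat_pow[of "coord_fun H n i" "e i"] co insert.prems v
      by (simp add: coord_fun_def)
    have "finprod ?R (\<lambda>i. coord_fun H n i [^]\<^bsub>?R\<^esub> e i) (insert i J) =
        coord_fun H n i [^]\<^bsub>?R\<^esub> e i \<otimes>\<^bsub>?R\<^esub> finprod ?R (\<lambda>i. coord_fun H n i [^]\<^bsub>?R\<^esub> e i) J"
      using insert co by (intro R.finprod_insert) auto
    moreover have "(\<Otimes>\<^bsub>H\<^esub>i\<in>insert i J. v i [^]\<^bsub>H\<^esub> e i) = v i [^]\<^bsub>H\<^esub> e i \<otimes>\<^bsub>H\<^esub> (\<Otimes>\<^bsub>H\<^esub>i\<in>J. v i [^]\<^bsub>H\<^esub> e i)"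
      using insert vc by (intro H.finprod_insert) auto
    ultimately show ?case
      using insert v by (simp add: rational_functions_simps(1) pw)
  qed
  show ?thesis
    by (simp add: monomial_fun_def rational_functions_simps(1) const_fun_def ev cong: restrict_cong)
qed

text \<open>Every rational function is congruent modulo \<open>K\<close> to the constant given by
  its value at \<open>v\<close>, once this is known for the coordinates.\<close>

lemma semifield_kernel_divide_eval:
  fixes H (structure) and n
  defines "R \<equiv> rational_functions H n"
  assumes H: "semifield H" and v: "v \<in> affine_space H n" and K: "semifield_kernel R K"
    and coord: "\<And>i. i \<in> {1..n} \<Longrightarrow> coord_fun H n i \<otimes>\<^bsub>R\<^esub> inv\<^bsub>R\<^esub> const_fun H n (v i) \<in> K"
    and f: "f \<in> carrier R"
  shows "f \<otimes>\<^bsub>R\<^esub> inv\<^bsub>R\<^esub> const_fun H n (f v) \<in> K"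
proof -
  interpret H: semifield H by fact
  interpret R: semifield R
    unfolding R_def by (rule semifield_rational_functions) fact
  interpret ev: group_hom R H "\<lambda>f. f v"
    unfolding R_def
    by (intro group_hom.intro group_hom_axioms.intro eval_hom H v R.is_group[unfolded R_def] H.is_group)
  interpret const: group_hom H R "const_fun H n"
    unfolding R_def
    by (intro group_hom.intro group_hom_axioms.intro const_fun_hom H R.is_group[unfolded R_def] H.is_group)
  interpret K: subgroup K R using K by (simp add: semifield_kernel_def)
  define Q where "Q = {f \<in> carrier R. f \<otimes>\<^bsub>R\<^esub> inv\<^bsub>R\<^esub> const_fun H n (f v) \<in> K}"
  have PR: "p \<in> carrier R" if "p \<in> polynomial_funs H n" for p
    using polynomial_funs_subset_rational_functions[OF H] that by (auto simp: R_def)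
  \<comment> \<open>\<open>Q\<close> is the preimage of \<open>K\<close> under the endomorphism
    dividing \<open>f\<close> by its value at \<open>v\<close>.\<close>
  have "subgroup Q R"
  proof (rule R.subgroupI)
    show "Q \<subseteq> carrier R" by (auto simp: Q_def)
    have "\<one>\<^bsub>R\<^esub> \<in> Q" by (simp add: Q_def)
    then show "Q \<noteq> {}" by blast
  next
    fix f assume "f \<in> Q"
    then have f: "f \<in> carrier R" "f \<otimes>\<^bsub>R\<^esub> inv\<^bsub>R\<^esub> const_fun H n (f v) \<in> K" by (auto simp: Q_def)
    then have "inv\<^bsub>R\<^esub> (f \<otimes>\<^bsub>R\<^esub> inv\<^bsub>R\<^esub> const_fun H n (f v)) \<in> K" by simp
    then show "inv\<^bsub>R\<^esub> f \<in> Q"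
      using f by (simp add: Q_def R.inv_mult)
  next
    fix f g assume "f \<in> Q" "g \<in> Q"
    then have fg: "f \<in> carrier R" "f \<otimes>\<^bsub>R\<^esub> inv\<^bsub>R\<^esub> const_fun H n (f v) \<in> K"
      "g \<in> carrier R" "g \<otimes>\<^bsub>R\<^esub> inv\<^bsub>R\<^esub> const_fun H n (g v) \<in> K" by (auto simp: Q_def)
    then have "(f \<otimes>\<^bsub>R\<^esub> inv\<^bsub>R\<^esub> const_fun H n (f v)) \<otimes>\<^bsub>R\<^esub> (g \<otimes>\<^bsub>R\<^esub> inv\<^bsub>R\<^esub> const_fun H n (g v)) \<in> K" by simp
    then show "f \<otimes>\<^bsub>R\<^esub> g \<in> Q"
      using fg by (simp add: Q_def R.inv_mult R.m_ac)
  qed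
  then interpret Q: subgroup Q R .
  have splus: "f \<oplus>\<^bsub>R\<^esub> g \<in> Q" if "f \<in> Q" "g \<in> Q" for f g
  proof -
    have fg: "f \<in> carrier R" "f \<otimes>\<^bsub>R\<^esub> inv\<^bsub>R\<^esub> const_fun H n (f v) \<in> K"
      "g \<in> carrier R" "g \<otimes>\<^bsub>R\<^esub> inv\<^bsub>R\<^esub> const_fun H n (g v) \<in> K" using that unfolding Q_def by auto
    \<comment> \<open>The denominator of the sum splits into the two given denominators, the form
      needed for the convex combination.\<close>
    have "const_fun H n ((f \<oplus>\<^bsub>R\<^esub> g) v) = const_fun H n (f v) \<oplus>\<^bsub>R\<^esub> const_fun H n (g v)"
      using v unfolding R_def const_fun_splus[symmetric] by (simp add: rational_functions_simps(2))
    then show ?thesis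
      using R.semifield_kernel_divide_splus[OF K, of f g] fg unfolding Q_def by simp
  qed
  \<comment> \<open>A constant divided by its value is \<open>\<one>\<close>.\<close>
  have const: "const_fun H n c \<in> Q" if "c \<in> carrier H" for c
  proof -
    have "const_fun H n c v = c" using v by (simp add: const_fun_def)
    then show ?thesis using that unfolding Q_def by simp
  qed
  have coord: "coord_fun H n i \<in> Q" if "i \<in> {1..n}" for i
  proof -
    have "coord_fun H n i v = v i" using v by (simp add: coord_fun_def)
    then show ?thesis using coord that coord_fun_polynomial[OF H that] PR unfolding Q_def by simp
  qed
  have finprod: "finprod R g J \<in> Q" if "finite J" "\<And>i. i \<in> J \<Longrightarrow> g i \<in> Q" for g and J :: "nat set"
    using that
  proof (induction J rule: finite_induct)
    case (insert i J)
    then have "finprod R g (insert i J) = g i \<otimes>\<^bsub>R\<^esub> finprod R g J"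
      by (intro R.finprod_insert) auto
    then show ?case using insert by simp
  qed simp
  have pow: "g [^]\<^bsub>R\<^esub> k \<in> Q" if "g \<in> Q" for g and k :: nat
    using that by (induction k) auto
  have monom: "monomial_fun H n c e \<in> Q" if "c \<in> carrier H" for c e
    unfolding monomial_fun_eq_finprod[OF H that] R_def[symmetric]
    by (intro Q.m_closed const finprod pow coord that) auto
  have poly: "p \<in> Q" if "p \<in> polynomial_funs H n" for p
    using that
  proof induction
    case (sum p q)
    \<comment> \<open>Polynomial sums are formed in the ambient function semifield, whose addition
      \<open>R\<close> inherits.\<close>
    have "p \<oplus>\<^bsub>function_semifield H (affine_space H n)\<^esub> q = p \<oplus>\<^bsub>R\<^esub> q"
      by (simp add: R_def rational_functions_def Let_def)
    then show ?case using splus[OF sum.IH] by simp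
  qed (rule monom)
  obtain p q where "p \<in> polynomial_funs H n" "q \<in> polynomial_funs H n" "f = p \<otimes>\<^bsub>R\<^esub> inv\<^bsub>R\<^esub> q"
    using f unfolding R_def by (rule rational_functions_divide[OF H])
  then have "f \<in> Q" by (auto intro: poly)
  then show ?thesis unfolding Q_def by simp
qed

section \<open>Maximality of the kernel of a point\<close>

theorem proposition0p2p5p15:
  fixes H :: "('a, 'm) semifield_scheme" and n :: nat and \<gamma> :: "nat \<Rightarrow> 'a"
  assumes "semifield H" and "bipotent H" and "archimedean H"
    and "\<And>i. i \<in> {1..n} \<Longrightarrow> \<gamma> i \<in> carrier H"
  shows "maximal_kernel (rational_functions H n)
    (kernel_generated (rational_functions H n)
      ((\<lambda>i. coord_fun H n i \<otimes>\<^bsub>rational_functions H n\<^esub>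
             inv\<^bsub>rational_functions H n\<^esub> const_fun H n (\<gamma> i)) ` {1..n}))"
proof -
  define R where "R = rational_functions H n"
  \<comment> \<open>Points of \<open>affine_space H n\<close> are extensional on
    \<open>{1..n}\<close>, hence the restriction.\<close>
  define v where "v = restrict \<gamma> {1..n}"
  let ?G = "(\<lambda>i. coord_fun H n i \<otimes>\<^bsub>R\<^esub> inv\<^bsub>R\<^esub> const_fun H n (\<gamma> i)) ` {1..n}"
  let ?K = "kernel_generated R ?G"
  interpret H: semifield H by fact
  interpret R: semifield R
    unfolding R_def by (rule semifield_rational_functions) fact
  have v: "v \<in> affine_space H n"
    using assms(4) by (simp add: v_def affine_space_def)
  interpret ev: group_hom R H "\<lambda>f. f v"
    unfolding R_def
    by (intro group_hom.intro group_hom_axioms.intro eval_hom assms(1) v R.is_group[unfolded R_def] H.is_group)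
  interpret const: group_hom H R "const_fun H n"
    unfolding R_def
    by (intro group_hom.intro group_hom_axioms.intro const_fun_hom assms(1) R.is_group[unfolded R_def] H.is_group)
  have "coord_fun H n i \<in> carrier R" if "i \<in> {1..n}" for i
    using coord_fun_polynomial[OF assms(1) that] polynomial_funs_subset_rational_functions[OF assms(1)]
    by (auto simp: R_def)
  then have G: "?G \<subseteq> carrier R" using assms(4) by auto
  note K = R.kernel_generated_is_smallest[OF G]
  have norm: "f \<otimes>\<^bsub>R\<^esub> inv\<^bsub>R\<^esub> const_fun H n (f v) \<in> ?K" if "f \<in> carrier R" for f
    using semifield_kernel_divide_eval[OF assms(1) v, of ?K f, folded R_def] K(1,2) that
    by (simp add: v_def image_subset_iff)
  have "A = carrier R" if A: "semifield_kernel R A" "?K \<subseteq> A" "A \<noteq> ?K" for A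
  proof -
    interpret A: subgroup A R using A(1) by (simp add: semifield_kernel_def)
    obtain f where f: "f \<in> A" "f \<notin> ?K" using A by blast
    define c where "c = f v"
    have c: "c \<in> carrier H" using f by (simp add: c_def)
    \<comment> \<open>If \<open>c\<close> were \<open>\<one>\<close>, then \<open>norm\<close> would
      put \<open>f\<close> itself into the generated kernel.\<close>
    have "c \<noteq> \<one>\<^bsub>H\<^esub>"
      using norm[of f] f by (auto simp: c_def)
    have "f \<otimes>\<^bsub>R\<^esub> inv\<^bsub>R\<^esub> const_fun H n c \<in> A"
      using norm[of f] f A(2) by (auto simp: c_def)
    \<comment> \<open>Dividing \<open>f\<close> by \<open>f / c\<close> recovers the constant
      \<open>c\<close>.\<close>
    then have "f \<otimes>\<^bsub>R\<^esub> inv\<^bsub>R\<^esub> (f \<otimes>\<^bsub>R\<^esub> inv\<^bsub>R\<^esub> const_fun H n c) \<in> A"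
      using f by blast
    then have "const_fun H n c \<in> A"
      using f c by (simp add: R.inv_mult del: R.inv_mult_group flip: R.m_assoc)
    then have power: "const_fun H n (c [^]\<^bsub>H\<^esub> k) \<in> A" for k :: int
      using c R.subgroup_int_pow_closed[OF A.subgroup_axioms] const.hom_int_pow by metis
    have const_A: "const_fun H n d \<in> A" if d: "d \<in> carrier H" for d
    proof -
      obtain j :: int where "c [^]\<^bsub>H\<^esub> j \<sqsubseteq>\<^bsub>H\<^esub> d"
        by (rule H.archimedean_lower_power[OF assms(2,3) c \<open>c \<noteq> \<one>\<^bsub>H\<^esub>\<close> d])
      moreover obtain k :: int where "d \<sqsubseteq>\<^bsub>H\<^esub> c [^]\<^bsub>H\<^esub> k"
        by (rule H.archimedean_upper_power[OF assms(2,3) c \<open>c \<noteq> \<one>\<^bsub>H\<^esub>\<close> d])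
      \<comment> \<open>\<open>const_fun\<close> preserves sums and hence the order, so
        \<open>const_fun H n d\<close> lies between two elements of \<open>A\<close>.\<close>
      ultimately show ?thesis
        using R.semifield_kernel_convex[OF A(1) power[of j] power[of k], of "const_fun H n d"] d
        by (simp add: semifield_le_def flip: const_fun_splus[of H n, folded R_def])
    qed
    have "g \<in> A" if g: "g \<in> carrier R" for g
    proof -
      \<comment> \<open>\<open>g\<close> is the product of its normalisation, which lies in the
        generated kernel and so in \<open>A\<close>, and the constant \<open>g v\<close>, also in
        \<open>A\<close>.\<close>
      have "(g \<otimes>\<^bsub>R\<^esub> inv\<^bsub>R\<^esub> const_fun H n (g v)) \<otimes>\<^bsub>R\<^esub> const_fun H n (g v) \<in> A"
        using A.m_closed[OF subsetD[OF A(2) norm[OF g]] const_A[of "g v"]] g by simp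
      moreover have "(g \<otimes>\<^bsub>R\<^esub> inv\<^bsub>R\<^esub> const_fun H n (g v)) \<otimes>\<^bsub>R\<^esub> const_fun H n (g v) = g"
        using g by (simp add: R.m_assoc)
      ultimately show ?thesis by simp
    qed
    then show ?thesis by auto
  qed
  then show ?thesis
    using K(1) unfolding maximal_kernel_def R_def by blast
qed

end
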